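(* Let $J\ge 1$, let $\mathcal{H}_1,\ldots,\mathcal{H}_J$ be real finite-dimensional Hilbert spaces with $\mathcal{H}_J=\mathcal{H}$, and let $A$ be a self-adjoint positive definite (SPD) linear operator on $\mathcal{H}$. Let $I_{k-1}^k:\mathcal{H}_{k-1}\to\mathcal{H}_k$ (prolongations, with trivial null space) and $I_k^{k-1}:\mathcal{H}_k\to\mathcal{H}_{k-1}$ (restrictions), $k=2,\ldots,J$, be linear operators. Let $A_k$ be linear operators on $\mathcal{H}_k$ with $A_J=A$, let $R_k$ be a linear operator on $\mathcal{H}_k$ for $k=1,\ldots,J$, and let $\bar{R}_k$ be a linear operator on $\mathcal{H}_k$ for $k=2,\ldots,J$. Let the linear operator $B$ on $\mathcal{H}$ (the multiplicative multigrid operator) be defined implicitly by $$I - BA = I - D_J A_J,$$ where $D_1 = R_1$ and, for $k=2,\ldots,J$, $D_k$ is the linear operator on $\mathcal{H}_k$ defined recursively by $$I - D_k A_k = (I - \bar{R}_k A_k)(I - I_{k-1}^k D_{k-1} I_k^{k-1} A_k)(I - R_k A_k).$$ Suppose that 1. $A_k$ is SPD on $\mathcal{H}_k$ for $k=2,\ldots,J$; 2. $I_k^{k-1} = c_k (I_{k-1}^k)^T$ with $c_k>0$, for $k=2,\ldots,J$; 3. $\bar{R}_k = R_k^T$ for $k=2,\ldots,J$; 4. $R_1 = R_1^T$; 5. $\| I - R_J A \|_A < 1$; 6. $\| I - R_k A_k \|_{A_k} \le 1$ for $k=2,\ldots,J-1$; 7. $R_1$ is non-negative on $\mathcal{H}_1$.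 Then $B$ is self-adjoint and positive definite on $\mathcal{H}$.
   Context: All inner products are written $(\cdot,\cdot)$; the inner products on the different spaces need not be related to each other. For a linear operator $N:\mathcal{H}_1'\to\mathcal{H}_2'$ between Hilbert spaces, $N^T:\mathcal{H}_2'\to\mathcal{H}_1'$ is the adjoint defined by $(Nu,v)_{\mathcal{H}_2'}=(u,N^Tv)_{\mathcal{H}_1'}$. An operator $M$ is positive definite if $(Mu,u)>0$ for all $u\ne0$, and non-negative if $(Mu,u)\ge0$ for all $u$; SPD means self-adjoint and positive definite. For an SPD operator $A_k$ on $\mathcal{H}_k$, $\|u\|_{A_k}=(A_ku,u)^{1/2}$ and $\|M\|_{A_k}$ is the induced operator norm. $I$ denotes the identity operator on the relevant space. The operators $D_k$, $k\ge2$, and $B=D_J$ are well defined since each $A_k$, $k\geq 2$, is invertible. *)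

theory Defs
  imports Complex_Main
begin

text \<open>
  The theorem quantifies over a list of spaces of arbitrary length and arbitrary, unrelated
  dimensions, so the spaces cannot be types. A finite-dimensional Hilbert space is represented by a
  subspace of an ambient real vector space, which supplies addition and scaling, together with an
  inner product of its own on that subspace. This is no restriction: a finite
  family of real vector spaces embeds in its direct sum, and completeness is automatic in finite
  dimension. Operators are total functions of which only the values on the
  carrier matter; equality of operators is therefore always stated pointwise on the carrier.
\<close>

record 'a hilb =
  carr :: "'a set"
  ip :: "'a \<Rightarrow> 'a \<Rightarrow> real"

definition fin_hilbert :: "'a::real_vector hilb \<Rightarrow> bool" where
  "fin_hilbert H \<longleftrightarrow>
     (\<exists>S. finite S \<and> carr H = span S) \<and>
     (\<forall>u\<in>carr H. \<forall>v\<in>carr H. \<forall>w\<in>carr H. ip H (u + v) w = ip H u w + ip H v w) \<and>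
     (\<forall>a. \<forall>u\<in>carr H. \<forall>v\<in>carr H. ip H (a *\<^sub>R u) v = a * ip H u v) \<and>
     (\<forall>u\<in>carr H. \<forall>v\<in>carr H. ip H u v = ip H v u) \<and>
     (\<forall>u\<in>carr H. u \<noteq> 0 \<longrightarrow> ip H u u > 0)"

definition lin_op :: "'a::real_vector hilb \<Rightarrow> 'a hilb \<Rightarrow> ('a \<Rightarrow> 'a) \<Rightarrow> bool" where
  "lin_op H K N \<longleftrightarrow>
     (\<forall>u\<in>carr H. N u \<in> carr K) \<and>
     (\<forall>u\<in>carr H. \<forall>v\<in>carr H. N (u + v) = N u + N v) \<and>
     (\<forall>a. \<forall>u\<in>carr H. N (a *\<^sub>R u) = a *\<^sub>R N u)"

definition op_eq :: "'a hilb \<Rightarrow> ('a \<Rightarrow> 'a) \<Rightarrow> ('a \<Rightarrow> 'a) \<Rightarrow> bool" where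
  "op_eq H M N \<longleftrightarrow> (\<forall>u\<in>carr H. M u = N u)"

definition adj :: "'a hilb \<Rightarrow> 'a hilb \<Rightarrow> ('a \<Rightarrow> 'a) \<Rightarrow> 'a \<Rightarrow> 'a" where
  "adj H K N v = (THE w. w \<in> carr H \<and> (\<forall>u\<in>carr H. ip K (N u) v = ip H u w))"

definition self_adj :: "'a hilb \<Rightarrow> ('a \<Rightarrow> 'a) \<Rightarrow> bool" where
  "self_adj H M \<longleftrightarrow> op_eq H M (adj H H M)"

definition pos_def :: "'a::zero hilb \<Rightarrow> ('a \<Rightarrow> 'a) \<Rightarrow> bool" where
  "pos_def H M \<longleftrightarrow> (\<forall>u\<in>carr H. u \<noteq> 0 \<longrightarrow> ip H (M u) u > 0)"

definition nonneg :: "'a hilb \<Rightarrow> ('a \<Rightarrow> 'a) \<Rightarrow> bool" where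
  "nonneg H M \<longleftrightarrow> (\<forall>u\<in>carr H. ip H (M u) u \<ge> 0)"

definition spd :: "'a::zero hilb \<Rightarrow> ('a \<Rightarrow> 'a) \<Rightarrow> bool" where
  "spd H M \<longleftrightarrow> self_adj H M \<and> pos_def H M"

definition enorm :: "'a hilb \<Rightarrow> ('a \<Rightarrow> 'a) \<Rightarrow> 'a \<Rightarrow> real" where
  "enorm H A u = sqrt (ip H (A u) u)"

text \<open>
  As in the library operator norm \<open>onorm\<close>, the vector \<open>0\<close> contributes \<open>0 / 0 = 0\<close>, so
  that the norm is also right on the zero space. The supremum is over a set that is bounded
  because the space is finite-dimensional.
\<close>

definition op_enorm :: "'a hilb \<Rightarrow> ('a \<Rightarrow> 'a) \<Rightarrow> ('a \<Rightarrow> 'a) \<Rightarrow> real" where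
  "op_enorm H A M = (SUP u\<in>carr H. enorm H A (M u) / enorm H A u)"

text \<open>The following lemmas show that the description in \<open>adj\<close> is proper.\<close>

lemma riesz_span:
  fixes f :: "'a::real_vector \<Rightarrow> real"
  assumes H: "fin_hilbert H" and S: "finite S" "span S \<subseteq> carr H"
    and f: "\<And>u v. u \<in> carr H \<Longrightarrow> v \<in> carr H \<Longrightarrow> f (u + v) = f u + f v"
      "\<And>a u. u \<in> carr H \<Longrightarrow> f (a *\<^sub>R u) = a * f u"
  shows "\<exists>w\<in>span S. \<forall>u\<in>span S. f u = ip H u w"
  using S f
proof (induction S arbitrary: f rule: finite_induct)
  case empty
  have 0: "0 \<in> carr H" using empty by (simp add: span_empty)
  have "f 0 = 0" using empty(3)[OF 0, of 0] by simp
  moreover have "ip H 0 0 = 0"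
    using H 0 unfolding fin_hilbert_def by (metis mult_zero_left scaleR_zero_left)
  ultimately show ?case by simp
next
  case (insert b S)
  have lin: "\<And>u v w. \<lbrakk>u \<in> carr H; v \<in> carr H; w \<in> carr H\<rbrakk> \<Longrightarrow> ip H (u + v) w = ip H u w + ip H v w"
    "\<And>a u v. \<lbrakk>u \<in> carr H; v \<in> carr H\<rbrakk> \<Longrightarrow> ip H (a *\<^sub>R u) v = a * ip H u v"
    and sym: "\<And>u v. \<lbrakk>u \<in> carr H; v \<in> carr H\<rbrakk> \<Longrightarrow> ip H u v = ip H v u"
    and pos: "\<And>u. \<lbrakk>u \<in> carr H; u \<noteq> 0\<rbrakk> \<Longrightarrow> ip H u u > 0"
    using H unfolding fin_hilbert_def by blast+
  have bH: "b \<in> carr H" using insert.prems(1) by (meson insertI1 span_base subsetD)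
  have SH: "span S \<subseteq> carr H" using insert.prems(1) span_mono[OF subset_insertI] by blast
  have sub: "subspace (carr H)"
    using H unfolding fin_hilbert_def by auto
  note cl = subspace_add[OF sub] subspace_scale[OF sub] subspace_diff[OF sub]
  obtain w where w: "w \<in> span S" "\<And>u. u \<in> span S \<Longrightarrow> f u = ip H u w"
    using insert.IH[OF SH insert.prems(2,3)] by blast
  obtain p where p: "p \<in> span S" "\<And>u. u \<in> span S \<Longrightarrow> ip H u b = ip H u p"
    using insert.IH[OF SH, of "\<lambda>u. ip H u b"] lin bH by auto
  define c where "c = b - p"
  have wH: "w \<in> carr H" and pH: "p \<in> carr H" using w p SH by auto
  have cH: "c \<in> carr H" unfolding c_def using bH pH cl by blast
  have bc: "b = p + c" by (simp add: c_def)
  have orth: "ip H u c = 0" if "u \<in> span S" for u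
  proof -
    have uH: "u \<in> carr H" using that SH by auto
    have "ip H u b = ip H u p + ip H u c"
      using lin(1)[OF pH cH uH] sym uH pH cH bH bc by metis
    then show ?thesis using p(2)[OF that] by simp
  qed
  define t where "t = f c / ip H c c"
  have tcc: "t * ip H c c = f c"
  proof (cases "c = 0")
    case True
    have "f 0 = 0" using insert.prems(3)[OF cH, of 0] by simp
    moreover have "ip H 0 0 = 0" using lin(2)[OF cH cH, of 0] True by simp
    ultimately show ?thesis by (simp add: True)
  next
    case False
    then show ?thesis using pos[OF cH] by (simp add: t_def)
  qed
  let ?w = "w + t *\<^sub>R c"
  have tcH: "t *\<^sub>R c \<in> carr H" using cl cH by blast
  have c_span: "c \<in> span (insert b S)"
    unfolding c_def using p(1) span_mono[OF subset_insertI, of S b]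
    by (meson insertI1 span_base span_diff subsetD)
  have "?w \<in> span (insert b S)"
    using c_span w(1) span_mono[OF subset_insertI, of S b] by (meson span_add span_scale subsetD)
  moreover have "f u = ip H u ?w" if u: "u \<in> span (insert b S)" for u
  proof -
    obtain k where k: "u - k *\<^sub>R b \<in> span S" using u span_breakdown_eq by blast
    define s where "s = u - k *\<^sub>R b + k *\<^sub>R p"
    have sS: "s \<in> span S" unfolding s_def using k p(1) by (meson span_add span_scale)
    have sH: "s \<in> carr H" using sS SH by auto
    have us: "u = s + k *\<^sub>R c" by (simp add: s_def c_def algebra_simps)
    have kcH: "k *\<^sub>R c \<in> carr H" using cl cH by blast
    have uH: "u \<in> carr H" using us sH kcH cl by auto
    have "ip H u ?w = ip H w u + ip H (t *\<^sub>R c) u"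
      using sym[OF uH cl(1)[OF wH tcH]] lin(1)[OF wH tcH uH] by simp
    also have "\<dots> = ip H u w + t * ip H u c"
      using sym[OF uH wH] sym[OF uH cH] lin(2)[OF cH uH] by simp
    also have "\<dots> = ip H s w + k * ip H c w + t * (ip H s c + k * ip H c c)"
      using lin(1)[OF sH kcH wH] lin(1)[OF sH kcH cH] lin(2)[OF cH wH] lin(2)[OF cH cH] us by simp
    also have "\<dots> = f s + k * (t * ip H c c)"
      using orth[OF sS] orth[OF w(1)] sym[OF cH wH] w(2)[OF sS] by simp
    also have "\<dots> = f u"
      using tcc us insert.prems(2)[OF sH kcH] insert.prems(3)[OF cH, of k] by simp
    finally show ?thesis by simp
  qed
  ultimately show ?case by blast
qed

lemma adj_unique:
  assumes "fin_hilbert H" "w \<in> carr H" "w' \<in> carr H"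
    and eq: "\<And>u. u \<in> carr H \<Longrightarrow> ip H u w = ip H u w'"
  shows "w = w'"
proof (rule ccontr)
  assume ne: "w \<noteq> w'"
  have "subspace (carr H)" using assms(1) unfolding fin_hilbert_def by auto
  then have d: "w - w' \<in> carr H" using assms subspace_diff by blast
  have pos: "ip H (w - w') (w - w') > 0"
    using assms(1) d ne unfolding fin_hilbert_def by simp
  have lin: "\<And>u v w. \<lbrakk>u \<in> carr H; v \<in> carr H; w \<in> carr H\<rbrakk> \<Longrightarrow> ip H (u + v) w = ip H u w + ip H v w"
    and sym: "\<And>u v. \<lbrakk>u \<in> carr H; v \<in> carr H\<rbrakk> \<Longrightarrow> ip H u v = ip H v u"
    using assms(1) unfolding fin_hilbert_def by blast+
  have "ip H w (w - w') = ip H (w - w') (w - w') + ip H w' (w - w')"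
    using lin[OF d assms(3) d] by simp
  then show False
    using pos eq[OF d] sym[OF assms(2) d] sym[OF assms(3) d] by simp
qed

lemma adj_spec:
  assumes H: "fin_hilbert H" and K: "fin_hilbert K" and N: "lin_op H K N" and v: "v \<in> carr K"
  shows "adj H K N v \<in> carr H \<and> (\<forall>u\<in>carr H. ip K (N u) v = ip H u (adj H K N v))"
  unfolding adj_def
proof (rule theI')
  obtain S where S: "finite S" "carr H = span S" using H unfolding fin_hilbert_def by blast
  have "\<exists>w\<in>span S. \<forall>u\<in>span S. ip K (N u) v = ip H u w"
    using N K v by (intro riesz_span[OF H S(1)]) (auto simp: S(2) lin_op_def fin_hilbert_def)
  then show "\<exists>!w. w \<in> carr H \<and> (\<forall>u\<in>carr H. ip K (N u) v = ip H u w)"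
    using adj_unique[OF H] S(2) by (metis (no_types, lifting))
qed

end

theory Submission
  imports Defs
begin

text \<open>
  Everything rests on one identity. Write \<open>E\<^sub>k = I - R\<^sub>k A\<^sub>k\<close> for the error propagator of the smoother.
  Since the post-smoother is the transpose of the pre-smoother, \<open>I - R\<^sub>k\<^sup>T A\<^sub>k\<close> is the adjoint of
  \<open>E\<^sub>k\<close> in the energy inner product \<open>(A\<^sub>k u, w)\<close>; since the restriction is \<open>c\<^sub>k\<close> times the transpose
  of the prolongation, the coarse correction becomes a form on the coarse space. Together they give
  \<open>(D\<^sub>k A\<^sub>k u, A\<^sub>k w) = (A\<^sub>k u, w) - (A\<^sub>k E\<^sub>k u, E\<^sub>k w) + c\<^sub>k\<^sup>-\<^sup>1 (D\<^sub>k\<^sub>-\<^sub>1 y(u), y(w))\<close> with \<open>y(u)\<close> the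
  restriction of \<open>A\<^sub>k E\<^sub>k u\<close>.

  If \<open>D\<^sub>k\<^sub>-\<^sub>1\<close> is self-adjoint and non-negative, the right-hand side is symmetric in \<open>u\<close> and \<open>w\<close>, and
  for \<open>u = w\<close> it is at least \<open>\<parallel>u\<parallel>\<^sup>2 - \<parallel>E\<^sub>k u\<parallel>\<^sup>2\<close> in the energy norm: non-negative if the smoother
  does not increase the energy, positive if it decreases the energy. As \<open>A\<^sub>k\<close> is onto, each
  vector has the form \<open>A\<^sub>k u\<close>, so these properties pass to \<open>D\<^sub>k\<close>
  (\<open>symmetric_cycle_self_adj\<close>, \<open>symmetric_cycle_nonneg\<close>, \<open>symmetric_cycle_pos_def\<close>). Induction over
  the levels starts at \<open>D\<^sub>1 = R\<^sub>1\<close> and gives the claim for \<open>D\<^sub>J\<close>, which agrees with \<open>B\<close> because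
  \<open>A\<close> is onto. With a single level there is no coarse space, and positivity of \<open>R\<^sub>1\<close> follows directly
  from the contraction property (\<open>contraction_imp_pos_def\<close>).

  The hypotheses on operator norms speak of suprema, which bound the quotients only
  when these are bounded; \<open>lin_op_bounded\<close> supplies this from finite dimension.
\<close>

section \<open>Inner products on the carrier\<close>

lemma fin_hilbert_subspace: "fin_hilbert H \<Longrightarrow> subspace (carr H)"
  unfolding fin_hilbert_def by auto

lemma ip_add_left:
  "\<lbrakk>fin_hilbert H; u \<in> carr H; v \<in> carr H; w \<in> carr H\<rbrakk> \<Longrightarrow> ip H (u + v) w = ip H u w + ip H v w"
  unfolding fin_hilbert_def by blast

lemma ip_scale_left:
  "\<lbrakk>fin_hilbert H; u \<in> carr H; v \<in> carr H\<rbrakk> \<Longrightarrow> ip H (a *\<^sub>R u) v = a * ip H u v"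
  unfolding fin_hilbert_def by blast

lemma ip_commute:
  "\<lbrakk>fin_hilbert H; u \<in> carr H; v \<in> carr H\<rbrakk> \<Longrightarrow> ip H u v = ip H v u"
  unfolding fin_hilbert_def by blast

lemma ip_pos: "\<lbrakk>fin_hilbert H; u \<in> carr H; u \<noteq> 0\<rbrakk> \<Longrightarrow> ip H u u > 0"
  unfolding fin_hilbert_def by blast

lemma ip_zero_left: "\<lbrakk>fin_hilbert H; v \<in> carr H\<rbrakk> \<Longrightarrow> ip H 0 v = 0"
  using ip_scale_left[of H v v 0] by simp

lemma ip_nonneg: "\<lbrakk>fin_hilbert H; u \<in> carr H\<rbrakk> \<Longrightarrow> ip H u u \<ge> 0"
  using ip_pos[of H u] ip_zero_left[of H 0] by (cases "u = 0") auto

lemma ip_diff_left: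
  assumes "fin_hilbert H" "u \<in> carr H" "v \<in> carr H" "w \<in> carr H"
  shows "ip H (u - v) w = ip H u w - ip H v w"
  using ip_add_left[OF assms(1) subspace_diff[OF fin_hilbert_subspace[OF assms(1)] assms(2,3)] assms(3,4)]
  by simp

lemma ip_diff_right:
  assumes "fin_hilbert H" "u \<in> carr H" "v \<in> carr H" "w \<in> carr H"
  shows "ip H w (u - v) = ip H w u - ip H w v"
  using ip_diff_left[OF assms] assms ip_commute[of H]
    subspace_diff[OF fin_hilbert_subspace[OF assms(1)] assms(2,3)] by metis

lemma ip_add_right:
  assumes "fin_hilbert H" "u \<in> carr H" "v \<in> carr H" "w \<in> carr H"
  shows "ip H w (u + v) = ip H w u + ip H w v"
  using ip_add_left[OF assms] assms ip_commute[of H]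
    subspace_add[OF fin_hilbert_subspace[OF assms(1)] assms(2,3)] by metis

lemma ip_scale_right:
  assumes "fin_hilbert H" "u \<in> carr H" "v \<in> carr H"
  shows "ip H u (a *\<^sub>R v) = a * ip H u v"
  using ip_scale_left[OF assms(1,3,2)] assms ip_commute[of H]
    subspace_scale[OF fin_hilbert_subspace[OF assms(1)] assms(3)] by metis

lemma lin_op_closed: "lin_op H K N \<Longrightarrow> u \<in> carr H \<Longrightarrow> N u \<in> carr K"
  unfolding lin_op_def by blast

lemma lin_op_diff:
  assumes "fin_hilbert H" "lin_op H K N" "u \<in> carr H" "v \<in> carr H"
  shows "N (u - v) = N u - N v"
proof -
  have "u - v \<in> carr H" using assms fin_hilbert_subspace subspace_diff by blast
  then have "N (u - v + v) = N (u - v) + N v" using assms unfolding lin_op_def by blast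
  then show ?thesis by simp
qed

lemma lin_op_zero: "fin_hilbert H \<Longrightarrow> lin_op H K N \<Longrightarrow> N 0 = 0"
  using lin_op_diff[of H K N 0 0] subspace_0[OF fin_hilbert_subspace[of H]] by simp

lemma lin_op_id_minus_comp:
  assumes H: "fin_hilbert H" and R: "lin_op H H R" and A: "lin_op H H A"
  shows "lin_op H H (\<lambda>u. u - R (A u))"
  using R A subspace_diff[OF fin_hilbert_subspace[OF H]]
  unfolding lin_op_def by (auto simp: algebra_simps)

lemma self_adj_ip:
  assumes "fin_hilbert H" "lin_op H H M" "self_adj H M" "u \<in> carr H" "v \<in> carr H"
  shows "ip H (M u) v = ip H u (M v)"
  using adj_spec[OF assms(1,1,2,5)] assms(3-5) unfolding self_adj_def op_eq_def by auto

lemma self_adjI: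
  assumes H: "fin_hilbert H" and M: "lin_op H H M"
    and sym: "\<And>u v. u \<in> carr H \<Longrightarrow> v \<in> carr H \<Longrightarrow> ip H (M u) v = ip H u (M v)"
  shows "self_adj H M"
  unfolding self_adj_def op_eq_def
proof
  fix v assume v: "v \<in> carr H"
  show "M v = adj H H M v"
    using adj_spec[OF H H M v] sym[OF _ v]
    by (intro adj_unique[OF H lin_op_closed[OF M v]]) auto
qed

section \<open>The energy inner product\<close>

definition energy_space :: "'a hilb \<Rightarrow> ('a \<Rightarrow> 'a) \<Rightarrow> 'a hilb" where
  "energy_space H A = \<lparr>carr = carr H, ip = \<lambda>u v. ip H (A u) v\<rparr>"

lemma energy_space_sel [simp]:
  "carr (energy_space H A) = carr H" "ip (energy_space H A) u v = ip H (A u) v"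
  by (simp_all add: energy_space_def)

lemma fin_hilbert_energy_space:
  assumes H: "fin_hilbert H" and A: "lin_op H H A" and spd: "spd H A"
  shows "fin_hilbert (energy_space H A)"
proof -
  have "ip H (A u) v = ip H (A v) u" if "u \<in> carr H" "v \<in> carr H" for u v
    using self_adj_ip[OF H A _ that] ip_commute[OF H that(1) lin_op_closed[OF A that(2)]] spd
    unfolding spd_def by simp
  then show ?thesis
    using H A spd unfolding fin_hilbert_def lin_op_def spd_def pos_def_def by simp
qed

text \<open>
  Representing the functional \<open>(\<cdot>, v)\<close> in the energy inner product yields a preimage of \<open>v\<close>.
\<close>

lemma spd_surj:
  assumes H: "fin_hilbert H" and A: "lin_op H H A" and spd: "spd H A" and v: "v \<in> carr H"
  obtains w where "w \<in> carr H" "A w = v"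
proof -
  obtain S where S: "finite S" "carr H = span S" using H unfolding fin_hilbert_def by blast
  obtain w where w: "w \<in> carr H" "\<And>u. u \<in> carr H \<Longrightarrow> ip H u v = ip H (A u) w"
    using riesz_span[OF fin_hilbert_energy_space[OF H A spd] S(1), of "\<lambda>u. ip H u v"]
      S(2) ip_add_left[OF H _ _ v] ip_scale_left[OF H _ v] by auto
  have "A w = v"
    using w self_adj_ip[OF H A _ _ w(1)] spd lin_op_closed[OF A w(1)] v
    by (intro adj_unique[OF H]) (auto simp: spd_def)
  with w(1) show thesis by (rule that)
qed

text \<open>
  Induction along a spanning set: a new vector is replaced by its component \<open>c\<close> orthogonal to the
  old span, so that \<open>\<parallel>s + k c\<parallel>\<^sup>2 = \<parallel>s\<parallel>\<^sup>2 + k\<^sup>2 \<parallel>c\<parallel>\<^sup>2\<close>, while the image obeys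
  \<open>\<parallel>x + y\<parallel>\<^sup>2 \<le> 2 \<parallel>x\<parallel>\<^sup>2 + 2 \<parallel>y\<parallel>\<^sup>2\<close>.
\<close>

lemma lin_op_bounded_span:
  assumes H: "fin_hilbert H" and K: "fin_hilbert K" and M: "lin_op H K M"
    and S: "finite S" "span S \<subseteq> carr H"
  shows "\<exists>C. \<forall>u\<in>span S. ip K (M u) (M u) \<le> C * ip H u u"
  using S
proof (induction S rule: finite_induct)
  case empty
  then show ?case
    using lin_op_zero[OF H M] ip_zero_left[OF K subspace_0[OF fin_hilbert_subspace[OF K]]]
      ip_zero_left[OF H subspace_0[OF fin_hilbert_subspace[OF H]]] by simp
next
  case (insert b S)
  note cl = subspace_add[OF fin_hilbert_subspace[OF H]] subspace_scale[OF fin_hilbert_subspace[OF H]]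
    subspace_diff[OF fin_hilbert_subspace[OF H]]
  have bH: "b \<in> carr H" using insert.prems by (meson insertI1 span_base subsetD)
  have SH: "span S \<subseteq> carr H" using insert.prems span_mono[OF subset_insertI] by blast
  obtain C where C: "\<And>u. u \<in> span S \<Longrightarrow> ip K (M u) (M u) \<le> C * ip H u u"
    using insert.IH[OF SH] by blast
  \<comment> \<open>the orthogonal projection of \<open>b\<close> onto \<open>span S\<close>\<close>
  obtain p where p: "p \<in> span S" "\<And>u. u \<in> span S \<Longrightarrow> ip H u b = ip H u p"
    using riesz_span[OF H insert.hyps(1) SH, of "\<lambda>u. ip H u b"]
      ip_add_left[OF H _ _ bH] ip_scale_left[OF H _ bH] by blast
  define c where "c = b - p"
  have pH: "p \<in> carr H" using p SH by auto
  have cH: "c \<in> carr H" unfolding c_def using bH pH cl by blast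
  have McK: "M c \<in> carr K" by (rule lin_op_closed[OF M cH])
  have orth: "ip H u c = 0" if "u \<in> span S" for u
    unfolding c_def using ip_diff_right[OF H bH pH] p(2)[OF that] SH that by auto
  obtain C' where C': "ip K (M c) (M c) \<le> C' * ip H c c"
  proof (cases "c = 0")
    case True
    then show thesis
      using that[of 0] lin_op_zero[OF H M]
        ip_zero_left[OF K subspace_0[OF fin_hilbert_subspace[OF K]]] by simp
  next
    case False
    then show thesis
      using that[of "ip K (M c) (M c) / ip H c c"] ip_pos[OF H cH] by simp
  qed
  define m where "m = max C C'"
  have m: "C \<le> m" "C' \<le> m" by (auto simp: m_def)
  have "ip K (M u) (M u) \<le> 2 * m * ip H u u" if u: "u \<in> span (insert b S)" for u
  proof -
    obtain k where k: "u - k *\<^sub>R b \<in> span S" using u span_breakdown_eq by blast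
    define s where "s = u - k *\<^sub>R b + k *\<^sub>R p"
    have sS: "s \<in> span S" unfolding s_def using k p(1) by (meson span_add span_scale)
    have sH: "s \<in> carr H" using sS SH by auto
    have us: "u = s + k *\<^sub>R c" by (simp add: s_def c_def algebra_simps)
    have kcH: "k *\<^sub>R c \<in> carr H" using cl cH by blast
    define x where "x = M s"
    define y where "y = k *\<^sub>R M c"
    have xK: "x \<in> carr K" unfolding x_def by (rule lin_op_closed[OF M sH])
    have yK: "y \<in> carr K" unfolding y_def using McK subspace_scale[OF fin_hilbert_subspace[OF K]] by blast
    have Mu: "M u = x + y" using M sH kcH cH us unfolding lin_op_def x_def y_def by auto
    \<comment> \<open>the parallelogram law, without the non-negative term \<open>(x - y, x - y)\<close>\<close>
    have "x - y \<in> carr K" "x + y \<in> carr K"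
      using xK yK fin_hilbert_subspace[OF K] by (auto intro: subspace_diff subspace_add)
    then have "ip K (x + y) (x + y) \<le> 2 * ip K x x + 2 * ip K y y"
      using xK yK ip_commute[OF K yK xK] ip_nonneg[OF K, of "x - y"]
      by (simp add: ip_add_left[OF K] ip_add_right[OF K] ip_diff_left[OF K] ip_diff_right[OF K])
    moreover have "ip K x x \<le> m * ip H s s"
      using C[OF sS] mult_right_mono[OF m(1) ip_nonneg[OF H sH]]
      unfolding x_def by linarith
    moreover have "ip K y y = k * k * ip K (M c) (M c)"
      using McK yK unfolding y_def by (simp add: ip_scale_left[OF K] ip_scale_right[OF K])
    moreover have "k * k * ip K (M c) (M c) \<le> k * k * (m * ip H c c)"
    proof (rule mult_left_mono)
      show "ip K (M c) (M c) \<le> m * ip H c c"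
        using C' mult_right_mono[OF m(2) ip_nonneg[OF H cH]] by linarith
    qed simp
    moreover have "ip H u u = ip H s s + k * k * ip H c c"
      unfolding us using sH cH kcH subspace_add[OF fin_hilbert_subspace[OF H] sH kcH] orth[OF sS] ip_commute[OF H cH sH]
      by (simp add: ip_add_left[OF H] ip_add_right[OF H] ip_scale_left[OF H] ip_scale_right[OF H])
    ultimately show ?thesis unfolding Mu by (simp add: algebra_simps)
  qed
  then show ?case by blast
qed

lemma lin_op_bounded:
  assumes "fin_hilbert H" "fin_hilbert K" "lin_op H K M"
  obtains C where "\<And>u. u \<in> carr H \<Longrightarrow> ip K (M u) (M u) \<le> C * ip H u u"
proof -
  obtain S where S: "finite S" "carr H = span S" using assms(1) unfolding fin_hilbert_def by blast
  show thesis using lin_op_bounded_span[OF assms S(1)] S(2) that by auto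
qed

lemma op_enorm_bound:
  assumes H: "fin_hilbert H" and A: "lin_op H H A" and spd: "spd H A" and M: "lin_op H H M"
    and u: "u \<in> carr H"
  shows "enorm H A (M u) / enorm H A u \<le> op_enorm H A M"
proof -
  let ?E = "energy_space H A"
  have E: "fin_hilbert ?E" by (rule fin_hilbert_energy_space[OF H A spd])
  have ME: "lin_op ?E ?E M" using M by (simp add: lin_op_def)
  obtain C where C: "\<And>u. u \<in> carr H \<Longrightarrow> ip H (A (M u)) (M u) \<le> C * ip H (A u) u"
    using lin_op_bounded[OF E E ME] by auto
  have "enorm H A (M u) / enorm H A u \<le> sqrt (max C 0)" if "u \<in> carr H" for u
  proof -
    have nn: "ip H (A u) u \<ge> 0" using ip_nonneg[OF E] that by simp
    have "ip H (A (M u)) (M u) \<le> max C 0 * ip H (A u) u"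
      using C[OF that] mult_right_mono[OF max.cobounded1[of C 0] nn] by linarith
    then have "enorm H A (M u) \<le> sqrt (max C 0) * enorm H A u"
      unfolding enorm_def by (metis real_sqrt_le_mono real_sqrt_mult)
    then show ?thesis
      using nn unfolding enorm_def
      by (cases "ip H (A u) u = 0") (simp_all add: divide_le_eq)
  qed
  then have "bdd_above ((\<lambda>u. enorm H A (M u) / enorm H A u) ` carr H)"
    by (intro bdd_aboveI2) auto
  then show ?thesis unfolding op_enorm_def using u by (intro cSUP_upper)
qed

lemma enorm_quotient_le_one_iff:
  assumes H: "fin_hilbert H" and A: "lin_op H H A" and spd: "spd H A"
    and u: "u \<in> carr H" "u \<noteq> 0"
  shows "enorm H A v / enorm H A u \<le> 1 \<longleftrightarrow> ip H (A v) v \<le> ip H (A u) u"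
    and "enorm H A v / enorm H A u < 1 \<longleftrightarrow> ip H (A v) v < ip H (A u) u"
proof -
  have "ip H (A u) u > 0" using u spd unfolding spd_def pos_def_def by blast
  then show "enorm H A v / enorm H A u \<le> 1 \<longleftrightarrow> ip H (A v) v \<le> ip H (A u) u"
    "enorm H A v / enorm H A u < 1 \<longleftrightarrow> ip H (A v) v < ip H (A u) u"
    unfolding enorm_def by (simp_all add: divide_le_eq divide_less_eq)
qed

lemma op_enorm_le_one:
  assumes H: "fin_hilbert H" and A: "lin_op H H A" and spd: "spd H A" and M: "lin_op H H M"
    and le: "op_enorm H A M \<le> 1" and u: "u \<in> carr H"
  shows "ip H (A (M u)) (M u) \<le> ip H (A u) u"
proof (cases "u = 0")
  case True
  then show ?thesis using lin_op_zero[OF H M] by simp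
next
  case False
  have "enorm H A (M u) / enorm H A u \<le> 1"
    using op_enorm_bound[OF H A spd M u] le by linarith
  then show ?thesis using enorm_quotient_le_one_iff(1)[OF H A spd u False] by blast
qed

lemma op_enorm_less_one:
  assumes H: "fin_hilbert H" and A: "lin_op H H A" and spd: "spd H A" and M: "lin_op H H M"
    and less: "op_enorm H A M < 1" and u: "u \<in> carr H" "u \<noteq> 0"
  shows "ip H (A (M u)) (M u) < ip H (A u) u"
proof -
  have "enorm H A (M u) / enorm H A u < 1"
    using op_enorm_bound[OF H A spd M u(1)] less by linarith
  then show ?thesis using enorm_quotient_le_one_iff(2)[OF H A spd u] by blast
qed

text \<open>
  Expanding the energy of \<open>u - R A u\<close> shows that a strict contraction has
  \<open>2 (R A u, A u) > \<parallel>R A u\<parallel>\<^sup>2\<close> in the energy norm, and every vector is some \<open>A u\<close>.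
\<close>

lemma contraction_imp_pos_def:
  assumes H: "fin_hilbert H" and A: "lin_op H H A" and spd: "spd H A" and R: "lin_op H H R"
    and less: "op_enorm H A (\<lambda>u. u - R (A u)) < 1"
  shows "pos_def H R"
  unfolding pos_def_def
proof (intro ballI impI)
  fix v assume v: "v \<in> carr H" "v \<noteq> 0"
  obtain u where u: "u \<in> carr H" "A u = v" using spd_surj[OF H A spd v(1)] .
  have u0: "u \<noteq> 0" using u v(2) lin_op_zero[OF H A] by auto
  define z where "z = R (A u)"
  have mem: "z \<in> carr H" "A u \<in> carr H" "A z \<in> carr H"
    unfolding z_def using A R u(1) by (auto simp: lin_op_def)
  have "ip H (A (u - z)) (u - z) < ip H (A u) u"
    using op_enorm_less_one[OF H A spd lin_op_id_minus_comp[OF H R A] less u(1) u0]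
    by (simp add: z_def)
  moreover have "ip H (A (u - z)) (u - z) = ip H (A u) u - ip H (A u) z - (ip H (A z) u - ip H (A z) z)"
    using mem u(1) subspace_diff[OF fin_hilbert_subspace[OF H]]
    by (simp add: lin_op_diff[OF H A] ip_diff_left[OF H] ip_diff_right[OF H])
  moreover have "ip H (A z) u = ip H z (A u)" "ip H (A u) z = ip H z (A u)"
    using self_adj_ip[OF H A _ mem(1) u(1)] ip_commute[OF H mem(2,1)] spd
    by (auto simp: spd_def)
  moreover have "ip H (A z) z \<ge> 0"
    using ip_nonneg[OF fin_hilbert_energy_space[OF H A spd], of z] mem(1) by simp
  ultimately show "ip H (R v) v > 0" using u(2) by (simp add: z_def)
qed

section \<open>One symmetric multigrid cycle\<close>

text \<open>
  The induction step over the levels, with \<open>H\<close> the fine and \<open>K\<close> the coarse space. Of the coarse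
  solver \<open>D'\<close> only self-adjointness enters here; its sign is a hypothesis of the positivity results, which use a
  non-expansive smoother on the intermediate levels and a strict contraction on the finest one.
\<close>

locale symmetric_cycle =
  fixes H K :: "'a::real_vector hilb" and A R Rbar P Q D D' :: "'a \<Rightarrow> 'a" and c :: real
  assumes H: "fin_hilbert H" and K: "fin_hilbert K"
    and A: "lin_op H H A" and spd: "spd H A"
    and R: "lin_op H H R" and Rbar: "lin_op H H Rbar"
    and P: "lin_op K H P" and Q: "lin_op H K Q"
    and D: "lin_op H H D" and D': "lin_op K K D'"
    and cycle: "op_eq H (\<lambda>u. u - D (A u))
        ((\<lambda>u. u - Rbar (A u)) \<circ> (\<lambda>u. u - P (D' (Q (A u)))) \<circ> (\<lambda>u. u - R (A u)))"
    and c_pos: "c > 0" and Q_adj: "op_eq H Q (\<lambda>v. c *\<^sub>R adj K H P v)"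
    and Rbar_adj: "op_eq H Rbar (adj H H R)"
    and D'_self_adj: "self_adj K D'"
begin

abbreviation smooth :: "'a \<Rightarrow> 'a" where "smooth u \<equiv> u - R (A u)"

lemma smooth_lin_op: "lin_op H H smooth"
  by (rule lin_op_id_minus_comp[OF H R A])

text \<open>Pre- and post-smoothing are adjoint to each other in the energy inner product.\<close>

lemma post_smooth_energy:
  assumes x: "x \<in> carr H" and w: "w \<in> carr H"
  shows "ip H (x - Rbar (A x)) (A w) = ip H (A x) (smooth w)"
proof -
  have mem: "A x \<in> carr H" "A w \<in> carr H" "Rbar (A x) \<in> carr H" "R (A w) \<in> carr H"
    using A R Rbar x w by (auto simp: lin_op_def)
  have "ip H (Rbar (A x)) (A w) = ip H (A w) (Rbar (A x))"
    using ip_commute[OF H mem(3,2)] .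
  also have "\<dots> = ip H (R (A w)) (A x)"
    using adj_spec[OF H H R mem(1)] Rbar_adj mem by (simp add: op_eq_def)
  also have "\<dots> = ip H (A x) (R (A w))" using ip_commute[OF H mem(4,1)] .
  finally have "ip H (Rbar (A x)) (A w) = ip H (A x) (R (A w))" .
  moreover have "ip H x (A w) = ip H (A x) w"
    using self_adj_ip[OF H A _ x w] spd by (simp add: spd_def)
  ultimately show ?thesis
    using mem x w by (simp add: ip_diff_left[OF H] ip_diff_right[OF H])
qed

lemma prolong_ip:
  assumes y: "y \<in> carr K" and v: "v \<in> carr H"
  shows "ip H (P y) v = ip K y (Q v) / c"
proof -
  have "ip K y (Q v) = c * ip K y (adj K H P v)"
    using Q_adj v y adj_spec[OF K H P v] by (simp add: op_eq_def ip_scale_right[OF K])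
  then show ?thesis using adj_spec[OF K H P v] y c_pos by simp
qed

text \<open>
  Moving the post-smoother to the other side turns the energy of \<open>(I - D A) u\<close> against \<open>w\<close> into that
  of the coarse-corrected \<open>smooth u\<close> against \<open>smooth w\<close>; the correction then moves to the coarse
  space. Symmetry and positivity of the cycle can be read off from the result.
\<close>

lemma cycle_energy:
  assumes u: "u \<in> carr H" and w: "w \<in> carr H"
  shows "ip H (D (A u)) (A w) = ip H (A u) w - ip H (A (smooth u)) (smooth w)
    + ip K (D' (Q (A (smooth u)))) (Q (A (smooth w))) / c"
proof -
  define e where "e = smooth u"
  define f where "f = smooth w"
  define y where "y = D' (Q (A e))"
  have e: "e \<in> carr H" and f: "f \<in> carr H"
    unfolding e_def f_def using lin_op_closed[OF smooth_lin_op] u w by blast+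
  have mem: "A u \<in> carr H" "A w \<in> carr H" "A e \<in> carr H" "A f \<in> carr H" "D (A u) \<in> carr H"
    "y \<in> carr K" "P y \<in> carr H" "A (P y) \<in> carr H"
    unfolding y_def using A D P Q D' u w e f by (auto simp: lin_op_def)
  have x: "e - P y \<in> carr H" using e mem(7) subspace_diff[OF fin_hilbert_subspace[OF H]] by blast
  have "u - D (A u) = (e - P y) - Rbar (A (e - P y))"
    using cycle u by (simp add: op_eq_def e_def y_def)
  then have "ip H (u - D (A u)) (A w) = ip H (A (e - P y)) f"
    using post_smooth_energy[OF x w] by (simp add: f_def)
  also have "\<dots> = ip H (A e) f - ip H (A (P y)) f"
    using lin_op_diff[OF H A e mem(7)] ip_diff_left[OF H mem(3,8) f] by simp
  also have "ip H (A (P y)) f = ip H (P y) (A f)"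
    using self_adj_ip[OF H A _ mem(7) f] spd by (simp add: spd_def)
  also have "\<dots> = ip K y (Q (A f)) / c" by (rule prolong_ip[OF mem(6,4)])
  finally have "ip H u (A w) - ip H (D (A u)) (A w) = ip H (A e) f - ip K y (Q (A f)) / c"
    using ip_diff_left[OF H u mem(5,2)] by simp
  moreover have "ip H u (A w) = ip H (A u) w"
    using self_adj_ip[OF H A _ u w] spd by (simp add: spd_def)
  ultimately show ?thesis unfolding e_def f_def y_def by simp
qed

lemma energy_commute:
  assumes "u \<in> carr H" "w \<in> carr H"
  shows "ip H (A u) w = ip H (A w) u"
  using ip_commute[OF fin_hilbert_energy_space[OF H A spd]] assms by simp

lemma symmetric_cycle_self_adj: "self_adj H D"
proof (rule self_adjI[OF H D])
  fix u' w' assume "u' \<in> carr H" "w' \<in> carr H"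
  then obtain u w where u: "u \<in> carr H" "A u = u'" and w: "w \<in> carr H" "A w = w'"
    using spd_surj[OF H A spd] by metis
  define y where "y = Q (A (smooth u))"
  define z where "z = Q (A (smooth w))"
  have mem: "smooth u \<in> carr H" "smooth w \<in> carr H"
    using lin_op_closed[OF smooth_lin_op] u(1) w(1) by blast+
  have memK: "y \<in> carr K" "z \<in> carr K" "D' z \<in> carr K"
    unfolding y_def z_def using mem A Q D' by (auto simp: lin_op_def)
  have "ip K (D' y) z = ip K (D' z) y"
    using self_adj_ip[OF K D' D'_self_adj memK(1,2)] ip_commute[OF K memK(1,3)] by simp
  then have "ip H (D (A u)) (A w) = ip H (D (A w)) (A u)"
    using cycle_energy[OF u(1) w(1)] cycle_energy[OF w(1) u(1)]
      energy_commute[OF u(1) w(1)] energy_commute[OF mem] by (simp add: y_def z_def)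
  also have "\<dots> = ip H (A u) (D (A w))"
    using u(1) w(1) A D by (intro ip_commute[OF H]) (auto simp: lin_op_def)
  finally show "ip H (D u') w' = ip H u' (D w')" unfolding u(2) w(2) .
qed

text \<open>A non-negative coarse solver can only add to the energy removed by the smoother.\<close>

lemma cycle_energy_ge:
  assumes nn: "nonneg K D'" and u: "u \<in> carr H"
  shows "ip H (D (A u)) (A u) \<ge> ip H (A u) u - ip H (A (smooth u)) (smooth u)"
proof -
  have "Q (A (smooth u)) \<in> carr K"
    using lin_op_closed[OF smooth_lin_op u] A Q by (auto simp: lin_op_def)
  then have "ip K (D' (Q (A (smooth u)))) (Q (A (smooth u))) / c \<ge> 0"
    using nn c_pos by (simp add: nonneg_def)
  then show ?thesis using cycle_energy[OF u u] by linarith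
qed

lemma symmetric_cycle_nonneg:
  assumes nn: "nonneg K D'" and le: "op_enorm H A smooth \<le> 1"
  shows "nonneg H D"
  unfolding nonneg_def
proof
  fix v assume "v \<in> carr H"
  then obtain u where u: "u \<in> carr H" "A u = v" using spd_surj[OF H A spd] by metis
  show "ip H (D v) v \<ge> 0"
    using cycle_energy_ge[OF nn u(1)] op_enorm_le_one[OF H A spd smooth_lin_op le u(1)] u(2)
    by simp
qed

lemma symmetric_cycle_pos_def:
  assumes nn: "nonneg K D'" and less: "op_enorm H A smooth < 1"
  shows "pos_def H D"
  unfolding pos_def_def
proof (intro ballI impI)
  fix v assume v: "v \<in> carr H" "v \<noteq> 0"
  obtain u where u: "u \<in> carr H" "A u = v" using spd_surj[OF H A spd v(1)] .
  have "u \<noteq> 0" using u v(2) lin_op_zero[OF H A] by auto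
  then show "ip H (D v) v > 0"
    using cycle_energy_ge[OF nn u(1)] op_enorm_less_one[OF H A spd smooth_lin_op less u(1)] u(2)
    by simp
qed

end

section \<open>The multigrid operator\<close>

lemma op_eq_self_adj_pos_def:
  assumes H: "fin_hilbert H" and N: "lin_op H H N" and eq: "op_eq H N M"
    and M: "lin_op H H M" "self_adj H M" "pos_def H M"
  shows "self_adj H N \<and> pos_def H N"
proof
  show "self_adj H N"
    using self_adj_ip[OF H M(1,2)] eq by (intro self_adjI[OF H N]) (simp add: op_eq_def)
  show "pos_def H N" using M(3) eq by (simp add: op_eq_def pos_def_def)
qed

theorem theorem3p10:
  fixes J :: nat
    and Hs :: "nat \<Rightarrow> 'a::real_vector hilb" and H :: "'a hilb"
    and A B :: "'a \<Rightarrow> 'a"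
    and As R Rbar P Q D :: "nat \<Rightarrow> 'a \<Rightarrow> 'a"
    and c :: "nat \<Rightarrow> real"
  assumes J: "J \<ge> 1"
    and hilb: "\<And>k. k \<in> {1..J} \<Longrightarrow> fin_hilbert (Hs k)"
    and HJ: "Hs J = H"
    and A_lin: "lin_op H H A" and A_spd: "spd H A"
    and P_lin: "\<And>k. k \<in> {2..J} \<Longrightarrow> lin_op (Hs (k - 1)) (Hs k) (P k)"
    and P_null: "\<And>k. k \<in> {2..J} \<Longrightarrow> {u \<in> carr (Hs (k - 1)). P k u = 0} = {0}"
    and Q_lin: "\<And>k. k \<in> {2..J} \<Longrightarrow> lin_op (Hs k) (Hs (k - 1)) (Q k)"
    and As_lin: "\<And>k. k \<in> {1..J} \<Longrightarrow> lin_op (Hs k) (Hs k) (As k)"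
    and AJ: "op_eq H (As J) A"
    and R_lin: "\<And>k. k \<in> {1..J} \<Longrightarrow> lin_op (Hs k) (Hs k) (R k)"
    and Rbar_lin: "\<And>k. k \<in> {2..J} \<Longrightarrow> lin_op (Hs k) (Hs k) (Rbar k)"
    and D_lin: "\<And>k. k \<in> {1..J} \<Longrightarrow> lin_op (Hs k) (Hs k) (D k)"
    and D_1: "op_eq (Hs 1) (D 1) (R 1)"
    and D_rec: "\<And>k. k \<in> {2..J} \<Longrightarrow>
      op_eq (Hs k) (\<lambda>u. u - D k (As k u))
        ((\<lambda>u. u - Rbar k (As k u)) \<circ>
         (\<lambda>u. u - P k (D (k - 1) (Q k (As k u)))) \<circ>
         (\<lambda>u. u - R k (As k u)))"
    and B_lin: "lin_op H H B"
    and B_def: "op_eq H (\<lambda>u. u - B (A u)) (\<lambda>u. u - D J (As J u))"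
    and c1: "\<And>k. k \<in> {2..J} \<Longrightarrow> spd (Hs k) (As k)"
    and c2: "\<And>k. k \<in> {2..J} \<Longrightarrow>
      c k > 0 \<and> op_eq (Hs k) (Q k) (\<lambda>v. c k *\<^sub>R adj (Hs (k - 1)) (Hs k) (P k) v)"
    and c3: "\<And>k. k \<in> {2..J} \<Longrightarrow> op_eq (Hs k) (Rbar k) (adj (Hs k) (Hs k) (R k))"
    and c4: "op_eq (Hs 1) (R 1) (adj (Hs 1) (Hs 1) (R 1))"
    and c5: "op_enorm H A (\<lambda>u. u - R J (A u)) < 1"
    and c6: "\<And>k. k \<in> {2..J - 1} \<Longrightarrow> op_enorm (Hs k) (As k) (\<lambda>u. u - R k (As k u)) \<le> 1"
    and c7: "nonneg (Hs 1) (R 1)"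
  shows "self_adj H B \<and> pos_def H B"
proof -
  have HH: "fin_hilbert H" using hilb[of J] J HJ by simp
  have cyc: "symmetric_cycle (Hs k) (Hs (k - 1)) (As k) (R k) (Rbar k) (P k) (Q k) (D k) (D (k - 1)) (c k)"
    if k: "k \<in> {2..J}" and sa: "self_adj (Hs (k - 1)) (D (k - 1))" for k
  proof -
    have k': "k \<in> {1..J}" "k - 1 \<in> {1..J}" using k by auto
    show ?thesis
      using hilb[OF k'(1)] hilb[OF k'(2)] As_lin[OF k'(1)] c1[OF k] R_lin[OF k'(1)] Rbar_lin[OF k]
        P_lin[OF k] Q_lin[OF k] D_lin[OF k'(1)] D_lin[OF k'(2)] D_rec[OF k] c2[OF k] c3[OF k] sa
      by unfold_locales auto
  qed
  have D1_self_adj: "self_adj (Hs 1) (D 1)"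
  proof -
    have one: "1 \<in> {1..J}" using J by simp
    have "self_adj (Hs 1) (R 1)" using c4 by (simp add: self_adj_def)
    then show ?thesis
      using self_adj_ip[OF hilb[OF one] R_lin[OF one]] D_1
      by (intro self_adjI[OF hilb[OF one] D_lin[OF one]]) (simp add: op_eq_def)
  qed
  have coarse: "self_adj (Hs k) (D k) \<and> nonneg (Hs k) (D k)" if "1 \<le> k" "k < J" for k
    using that
  proof (induction k rule: nat_induct_at_least)
    case base
    then show ?case using D1_self_adj D_1 c7 by (simp add: op_eq_def nonneg_def)
  next
    case (Suc n)
    then have IH: "self_adj (Hs n) (D n)" "nonneg (Hs n) (D n)"
      and k: "Suc n \<in> {2..J}" "Suc n \<in> {2..J - 1}" by auto
    interpret symmetric_cycle "Hs (Suc n)" "Hs n" "As (Suc n)" "R (Suc n)" "Rbar (Suc n)"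
      "P (Suc n)" "Q (Suc n)" "D (Suc n)" "D n" "c (Suc n)"
      using cyc[OF k(1)] IH(1) by simp
    show ?case using symmetric_cycle_self_adj symmetric_cycle_nonneg[OF IH(2) c6[OF k(2)]] by blast
  qed
  have D_J: "self_adj H (D J) \<and> pos_def H (D J)"
  proof (cases "J = 1")
    case True
    then have "lin_op H H (R 1)" "op_enorm H A (\<lambda>u. u - R 1 (A u)) < 1"
      using R_lin[of 1] HJ c5 by auto
    then have "pos_def H (R 1)" using contraction_imp_pos_def[OF HH A_lin A_spd] by blast
    then show ?thesis using D1_self_adj D_1 HJ True by (auto simp: op_eq_def pos_def_def)
  next
    case False
    then have k: "J \<in> {2..J}" "1 \<le> J - 1" "J - 1 < J" using J by auto
    interpret symmetric_cycle "Hs J" "Hs (J - 1)" "As J" "R J" "Rbar J" "P J" "Q J"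
      "D J" "D (J - 1)" "c J"
      using cyc[OF k(1)] coarse[OF k(2,3)] by blast
    have "R J (As J u) = R J (A u)" "R J (A u) \<in> carr H" if "u \<in> carr H" for u
      using AJ that R_lin[of J] J HJ A_lin by (auto simp: op_eq_def lin_op_def)
    then have "op_enorm H (As J) (\<lambda>u. u - R J (As J u)) = op_enorm H A (\<lambda>u. u - R J (A u))"
      unfolding op_enorm_def enorm_def
      using AJ subspace_diff[OF fin_hilbert_subspace[OF HH]] by (intro SUP_cong) (auto simp: op_eq_def)
    then show ?thesis
      using symmetric_cycle_self_adj symmetric_cycle_pos_def coarse[OF k(2,3)] c5 HJ by simp
  qed
  have "op_eq H B (D J)"
    unfolding op_eq_def
  proof
    fix v assume "v \<in> carr H"
    then obtain u where "u \<in> carr H" "A u = v" using spd_surj[OF HH A_lin A_spd] by metis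
    then show "B v = D J v" using B_def AJ by (auto simp: op_eq_def)
  qed
  then show ?thesis
    using op_eq_self_adj_pos_def[OF HH B_lin] D_lin[of J] D_J J HJ by simp
qed

end
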